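(* Let $p$ be a prime and let $G$ be a finite two-generator $p$-group. Then $G$ determines a uniquely regular dessin if and only if $G$ is maximally automorphic.
   Context: A dessin is a 2-cell embedding of a connected 2-coloured bipartite graph (multiple edges allowed) into a compact Riemann surface. An automorphism of a dessin is a colour-preserving automorphism of the underlying graph, regarded as a permutation of the edges, which extends to a conformal self-homeomorphism of the supporting surface; isomorphisms are defined analogously. The automorphism group of a dessin acts semiregularly on the edges; the dessin is called regular if this action is transitive. The automorphism group of a regular dessin is a two-generator finite group, and for a given two-generator finite group $G$ the isomorphism classes of regular dessins with automorphism group isomorphic to $G$ are in one-to-one correspondence with the orbits of $\mathrm{Aut}(G)$ on the ordered generating pairs of $G$ (known fact). $G$ determines a uniquely regular dessin if there is only one such orbit, i.e. if up to isomorphism there is exactly one regular dessin with automorphism group isomorphic to $G$. "Two-generator $p$-group" means that the minimal number of generators is $2$. A finite $p$-group $G$ of order $p^n$ whose minimal number of generators is $d$ is called maximally automorphic if $|\mathrm{Aut}(G)|=p^{d(n-d)}(p^d-1)(p^d-p)\cdots(p^d-p^{d-1})$ (by a theorem of P. Hall, $|\mathrm{Aut}(G)|$ always divides the right-hand side); here $d=2$. *)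

theory Defs
  imports "HOL-Algebra.Algebra" "HOL-Computational_Algebra.Primes"
begin

section \<open>Groups\<close>

definition min_generators :: "('a, 'b) monoid_scheme \<Rightarrow> nat" where
  "min_generators G =
     (LEAST d. \<exists>S\<subseteq>carrier G. finite S \<and> card S = d \<and> generate G S = carrier G)"

definition maximally_automorphic :: "nat \<Rightarrow> ('a, 'b) monoid_scheme \<Rightarrow> bool" where
  "maximally_automorphic p G \<longleftrightarrow>
     (let d = min_generators G in
        \<exists>n. order G = p ^ n \<and>
            order (AutoGroup G) = p ^ (d * (n - d)) * (\<Prod>i<d. p ^ d - p ^ i))"

definition generating_pairs :: "('a, 'b) monoid_scheme \<Rightarrow> ('a \<times> 'a) set" where
  "generating_pairs G =
     {(a, b). a \<in> carrier G \<and> b \<in> carrier G \<and> generate G {a, b} = carrier G}"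

text \<open>
  A finite group determines a uniquely regular dessin if its automorphism group has exactly one
  orbit on the ordered generating pairs. That this is the same as having, up to isomorphism,
  exactly one regular dessin with automorphism group isomorphic to the group is proved below as
  \<open>determines_unique_regular_dessin_iff\<close>.
\<close>

definition determines_unique_regular_dessin :: "('a, 'b) monoid_scheme \<Rightarrow> bool" where
  "determines_unique_regular_dessin G \<longleftrightarrow>
     card (orbits (AutoGroup G) (generating_pairs G) (\<lambda>f. map_prod f f)) = 1"


section \<open>Regular dessins and generating pairs\<close>

text \<open>
  A dessin is encoded by its finite set of edges \<open>E\<close> with the two permutations \<open>x\<close> and \<open>y\<close> that
  rotate the edges around their black and white end points, following the orientation of the
  surface. The graph is connected iff \<open>x\<close> and \<open>y\<close> generate a transitive group; black vertices,
  white vertices and faces are the cycles of \<open>x\<close>, \<open>y\<close> and \<open>xy\<close>. Colour-preserving graph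
  isomorphisms that extend to conformal homeomorphisms are the bijections of the edges that
  commute with both rotations.
\<close>

definition dessin :: "'e set \<Rightarrow> ('e \<Rightarrow> 'e) \<Rightarrow> ('e \<Rightarrow> 'e) \<Rightarrow> bool" where
  "dessin E x y \<longleftrightarrow> finite E \<and> E \<noteq> {} \<and> x \<in> Bij E \<and> y \<in> Bij E \<and>
     (\<forall>e\<in>E. \<forall>e'\<in>E. \<exists>g\<in>generate (BijGroup E) {x, y}. g e = e')"

definition dessin_isos ::
  "'e set \<Rightarrow> ('e \<Rightarrow> 'e) \<Rightarrow> ('e \<Rightarrow> 'e) \<Rightarrow> 'f set \<Rightarrow> ('f \<Rightarrow> 'f) \<Rightarrow> ('f \<Rightarrow> 'f) \<Rightarrow> ('e \<Rightarrow> 'f) set" where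
  "dessin_isos E x y E' x' y' =
     {f \<in> extensional E. bij_betw f E E' \<and> (\<forall>e\<in>E. f (x e) = x' (f e) \<and> f (y e) = y' (f e))}"

definition dessin_Aut :: "'e set \<Rightarrow> ('e \<Rightarrow> 'e) \<Rightarrow> ('e \<Rightarrow> 'e) \<Rightarrow> ('e \<Rightarrow> 'e) monoid" where
  "dessin_Aut E x y = BijGroup E \<lparr>carrier := dessin_isos E x y E x y\<rparr>"

definition regular_dessin :: "'e set \<Rightarrow> ('e \<Rightarrow> 'e) \<Rightarrow> ('e \<Rightarrow> 'e) \<Rightarrow> bool" where
  "regular_dessin E x y \<longleftrightarrow> dessin E x y \<and>
     (\<forall>e\<in>E. \<forall>e'\<in>E. \<exists>f\<in>carrier (dessin_Aut E x y). f e = e')"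

definition right_mult :: "('a, 'b) monoid_scheme \<Rightarrow> 'a \<Rightarrow> 'a \<Rightarrow> 'a" where
  "right_mult G a = (\<lambda>g\<in>carrier G. g \<otimes>\<^bsub>G\<^esub> a)"

lemma BijGroup_simps:
  "carrier (BijGroup E) = Bij E"
  "f \<in> Bij E \<Longrightarrow> g \<in> Bij E \<Longrightarrow> f \<otimes>\<^bsub>BijGroup E\<^esub> g = compose E f g"
  "\<one>\<^bsub>BijGroup E\<^esub> = (\<lambda>x\<in>E. x)"
  by (auto simp: BijGroup_def)

lemma Bij_in: "f \<in> Bij E \<Longrightarrow> e \<in> E \<Longrightarrow> f e \<in> E"
  using Bij_imp_funcset by blast

lemma dessin_isos_Bij: "dessin_isos E x y E x y \<subseteq> Bij E"
  by (auto simp: dessin_isos_def Bij_def)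

lemma dessin_isos_compose:
  assumes "f \<in> dessin_isos E x y E' x' y'" "g \<in> dessin_isos E' x' y' E'' x'' y''"
    and "x \<in> Bij E" "y \<in> Bij E"
  shows "compose E g f \<in> dessin_isos E x y E'' x'' y''"
proof -
  have "bij_betw (compose E g f) E E''"
    using assms by (auto simp: dessin_isos_def intro: bij_betw_compose)
  moreover have "f e \<in> E'" if "e \<in> E" for e
    using assms that by (auto simp: dessin_isos_def dest: bij_betwE)
  ultimately show ?thesis
    using assms by (auto simp: dessin_isos_def compose_def Bij_in)
qed

lemma dessin_isos_inv:
  assumes f: "f \<in> dessin_isos E x y E' x' y'" and xy: "x \<in> Bij E" "y \<in> Bij E"
  shows "restrict (inv_into E f) E' \<in> dessin_isos E' x' y' E x y"
proof -
  have b: "bij_betw f E E'" using f by (auto simp: dessin_isos_def)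
  have inv: "inv_into E f (f e) = e" if "e \<in> E" for e
    using b that by (simp add: bij_betw_def)
  have b': "bij_betw (inv_into E f) E' E" using b by (rule bij_betw_inv_into)
  have "inv_into E f (x' e) = x (inv_into E f e) \<and> inv_into E f (y' e) = y (inv_into E f e) \<and>
        x' e \<in> E' \<and> y' e \<in> E'" if "e \<in> E'" for e
  proof -
    obtain d where d: "d \<in> E" "e = f d" using b \<open>e \<in> E'\<close> by (auto simp: bij_betw_def)
    have "x' e = f (x d)" "y' e = f (y d)" "x d \<in> E" "y d \<in> E"
      using f d xy by (auto simp: dessin_isos_def Bij_in)
    then show ?thesis using d inv b by (auto dest: bij_betwE)
  qed
  then show ?thesis
    using b' by (auto simp: dessin_isos_def cong: bij_betw_cong)
qed

lemma group_dessin_Aut: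
  assumes "x \<in> Bij E" "y \<in> Bij E"
  shows "subgroup (dessin_isos E x y E x y) (BijGroup E)" "group (dessin_Aut E x y)"
proof -
  show *: "subgroup (dessin_isos E x y E x y) (BijGroup E)"
  proof (rule group.subgroupI[OF group_BijGroup])
    show "dessin_isos E x y E x y \<subseteq> carrier (BijGroup E)"
      using dessin_isos_Bij by (auto simp: BijGroup_simps)
    have "(\<lambda>e\<in>E. e) \<in> dessin_isos E x y E x y"
      using id_Bij[of E] assms by (auto simp: dessin_isos_def Bij_def Bij_in dest: bij_betwE)
    then show "dessin_isos E x y E x y \<noteq> {}" by blast
  next
    fix f assume f: "f \<in> dessin_isos E x y E x y"
    then show "inv\<^bsub>BijGroup E\<^esub> f \<in> dessin_isos E x y E x y"
      using dessin_isos_inv[OF f assms] dessin_isos_Bij inv_BijGroup[of f E] by fastforce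
    fix g assume g: "g \<in> dessin_isos E x y E x y"
    show "f \<otimes>\<^bsub>BijGroup E\<^esub> g \<in> dessin_isos E x y E x y"
      using dessin_isos_compose[OF g f assms] f g
      by (metis BijGroup_simps(2) dessin_isos_Bij subsetD)
  qed
  show "group (dessin_Aut E x y)"
    unfolding dessin_Aut_def by (rule subgroup.subgroup_is_group[OF * group_BijGroup])
qed

lemma dessin_orbit_induct:
  assumes D: "dessin E x y" and e0: "e0 \<in> E" and P0: "P e0"
    and step: "\<And>e. e \<in> E \<Longrightarrow> P e \<longleftrightarrow> P (x e)" "\<And>e. e \<in> E \<Longrightarrow> P e \<longleftrightarrow> P (y e)"
    and e: "e \<in> E"
  shows "P e"
proof -
  have xy: "x \<in> Bij E" "y \<in> Bij E" using D by (auto simp: dessin_def)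
  have "g \<in> Bij E \<and> (\<forall>e\<in>E. P e \<longleftrightarrow> P (g e))" if "g \<in> generate (BijGroup E) {x, y}" for g
    using that
  proof induction
    case one
    show ?case unfolding BijGroup_simps by (intro conjI id_Bij) simp
  next
    case (incl h)
    then show ?case using xy step by auto
  next
    case (inv h)
    then have h: "h \<in> Bij E" "\<And>e. e \<in> E \<Longrightarrow> P e \<longleftrightarrow> P (h e)" using xy step by auto
    have "P e \<longleftrightarrow> P (inv_into E h e)" if "e \<in> E" for e
      using h(2)[of "inv_into E h e"] h(1) that Bij_inv_into_mem[OF h(1) that]
      by (metis Bij_def Int_Collect bij_betw_inv_into_right)
    then show ?case
      unfolding inv_BijGroup[OF h(1)] by (intro conjI restrict_inv_into_Bij[OF h(1)]) simp
  next
    case (eng h1 h2)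
    then have h: "h1 \<in> Bij E" "h2 \<in> Bij E" by blast+
    have "P e \<longleftrightarrow> P (h1 (h2 e))" if "e \<in> E" for e
      using eng.IH that Bij_in[OF h(2) that] by blast
    then show ?case
      unfolding BijGroup_simps(2)[OF h]
      by (intro conjI compose_Bij h) (simp add: compose_eq)
  qed
  moreover obtain g where "g \<in> generate (BijGroup E) {x, y}" "g e0 = e"
    using D e0 e unfolding dessin_def by metis
  ultimately show ?thesis using P0 e0 by auto
qed

lemma dessin_iso_eqI:
  assumes D: "dessin E x y" and e0: "e0 \<in> E" and "f e0 = g e0"
    and f: "f \<in> dessin_isos E x y E' x' y'" and g: "g \<in> dessin_isos E x y E' x' y'"
    and xy': "x' \<in> Bij E'" "y' \<in> Bij E'"
  shows "f = g"
proof (rule extensionalityI)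
  show "f \<in> extensional E" "g \<in> extensional E" using f g by (auto simp: dessin_isos_def)
  have fg: "f e \<in> E'" "g e \<in> E'" if "e \<in> E" for e
    using f g that by (auto simp: dessin_isos_def dest: bij_betwE)
  have inj: "inj_on x' E'" "inj_on y' E'" using xy' by (auto simp: Bij_def bij_betw_def)
  fix e assume "e \<in> E"
  show "f e = g e"
  proof (rule dessin_orbit_induct[OF D e0 _ _ _ \<open>e \<in> E\<close>, where P = "\<lambda>e. f e = g e"])
    show "f e0 = g e0" by fact
    show "f e = g e \<longleftrightarrow> f (x e) = g (x e)" "f e = g e \<longleftrightarrow> f (y e) = g (y e)" if "e \<in> E" for e
      using f g that inj_on_eq_iff[OF inj(1) fg[OF that]] inj_on_eq_iff[OF inj(2) fg[OF that]]
      by (simp_all add: dessin_isos_def)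
  qed
qed

context group
begin

lemma right_mult_Bij:
  assumes "a \<in> carrier G" shows "right_mult G a \<in> Bij (carrier G)"
proof -
  have "bij_betw (\<lambda>g. g \<otimes> a) (carrier G) (carrier G)"
    by (rule bij_betw_byWitness[where f' = "\<lambda>g. g \<otimes> inv a"]) (use assms in \<open>auto simp: m_assoc\<close>)
  then show ?thesis by (auto simp: Bij_def right_mult_def cong: bij_betw_cong)
qed

lemma left_mult_iso:
  assumes "g \<in> carrier G" "a \<in> carrier G" "b \<in> carrier G"
  shows "(\<lambda>h\<in>carrier G. g \<otimes> h) \<in> dessin_isos (carrier G) (right_mult G a) (right_mult G b)
                                    (carrier G) (right_mult G a) (right_mult G b)"
proof -
  have "bij_betw (\<lambda>h. g \<otimes> h) (carrier G) (carrier G)"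
    by (rule bij_betw_byWitness[where f' = "\<lambda>h. inv g \<otimes> h"])
       (use assms in \<open>auto simp: m_assoc[symmetric]\<close>)
  then show ?thesis
    using assms by (auto simp: dessin_isos_def right_mult_def m_assoc cong: bij_betw_cong)
qed

lemma generate_right_mult:
  assumes "h \<in> generate G {a, b}" "a \<in> carrier G" "b \<in> carrier G"
  shows "right_mult G h \<in> generate (BijGroup (carrier G)) {right_mult G a, right_mult G b}"
  using assms(1)
proof induction
  case one
  have "right_mult G \<one> = \<one>\<^bsub>BijGroup (carrier G)\<^esub>"
    by (auto simp: right_mult_def BijGroup_simps)
  then show ?case by (simp add: generate.one)
next
  case (incl h)
  then show ?case by (auto intro: generate.incl)
next
  case (inv h)
  then have h: "h \<in> carrier G" using assms by auto
  have "right_mult G (inv h) = inv\<^bsub>BijGroup (carrier G)\<^esub> (right_mult G h)"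
  proof (rule sym, rule group.inv_equality[OF group_BijGroup])
    show "right_mult G (inv h) \<otimes>\<^bsub>BijGroup (carrier G)\<^esub> right_mult G h = \<one>\<^bsub>BijGroup (carrier G)\<^esub>"
      using h right_mult_Bij[OF h] right_mult_Bij[OF inv_closed[OF h]]
      by (auto simp: BijGroup_simps fun_eq_iff compose_def m_assoc) (auto simp: right_mult_def m_assoc)
  qed (use h in \<open>auto simp: BijGroup_simps right_mult_Bij\<close>)
  then show ?case using inv by (auto intro: generate.inv)
next
  case (eng h k)
  have hk: "h \<in> carrier G" "k \<in> carrier G"
    using eng(1,2) generate_in_carrier[of "{a, b}"] assms by auto
  have "right_mult G (h \<otimes> k) = right_mult G k \<otimes>\<^bsub>BijGroup (carrier G)\<^esub> right_mult G h"
    using hk right_mult_Bij[OF hk(1)] right_mult_Bij[OF hk(2)]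
    by (auto simp: BijGroup_simps fun_eq_iff compose_def) (auto simp: right_mult_def m_assoc)
  then show ?case using generate.eng[OF eng(4) eng(3)] by simp
qed

lemma generating_pair_dessin:
  assumes fin: "finite (carrier G)" and ab: "(a, b) \<in> generating_pairs G"
  shows "regular_dessin (carrier G) (right_mult G a) (right_mult G b)"
    and "dessin_Aut (carrier G) (right_mult G a) (right_mult G b) \<cong> G"
proof -
  let ?E = "carrier G" and ?x = "right_mult G a" and ?y = "right_mult G b"
  have ab': "a \<in> ?E" "b \<in> ?E" "generate G {a, b} = ?E"
    using ab by (auto simp: generating_pairs_def)
  note bij = right_mult_Bij[OF ab'(1)] right_mult_Bij[OF ab'(2)]
  have "\<exists>g\<in>generate (BijGroup ?E) {?x, ?y}. g e = e'" if "e \<in> ?E" "e' \<in> ?E" for e e'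
  proof
    show "right_mult G (inv e \<otimes> e') \<in> generate (BijGroup ?E) {?x, ?y}"
      using that ab' by (intro generate_right_mult) auto
    show "right_mult G (inv e \<otimes> e') e = e'"
      using that by (auto simp: right_mult_def m_assoc[symmetric])
  qed
  then have D: "dessin ?E ?x ?y"
    unfolding dessin_def using fin bij by auto
  show "regular_dessin ?E ?x ?y"
    unfolding regular_dessin_def
  proof (intro conjI ballI D)
    fix e e' assume e: "e \<in> ?E" "e' \<in> ?E"
    show "\<exists>f\<in>carrier (dessin_Aut ?E ?x ?y). f e = e'"
    proof
      show "(\<lambda>h\<in>?E. (e' \<otimes> inv e) \<otimes> h) \<in> carrier (dessin_Aut ?E ?x ?y)"
        unfolding dessin_Aut_def using e ab' left_mult_iso[of "e' \<otimes> inv e" a b] by auto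
      show "(\<lambda>h\<in>?E. (e' \<otimes> inv e) \<otimes> h) e = e'"
        using e by (auto simp: m_assoc)
    qed
  qed
  let ?L = "\<lambda>g. \<lambda>h\<in>?E. g \<otimes> h"
  have L: "?L g \<in> dessin_isos ?E ?x ?y ?E ?x ?y" if "g \<in> ?E" for g
    using left_mult_iso that ab' by auto
  have "?L \<in> hom G (dessin_Aut ?E ?x ?y)"
  proof (rule homI)
    show "?L g \<in> carrier (dessin_Aut ?E ?x ?y)" if "g \<in> ?E" for g
      using L[OF that] by (auto simp: dessin_Aut_def)
    show "?L (g \<otimes> k) = ?L g \<otimes>\<^bsub>dessin_Aut ?E ?x ?y\<^esub> ?L k" if "g \<in> ?E" "k \<in> ?E" for g k
    proof -
      have "?L g \<otimes>\<^bsub>dessin_Aut ?E ?x ?y\<^esub> ?L k = compose ?E (?L g) (?L k)"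
        using L[OF that(1)] L[OF that(2)] dessin_isos_Bij
        by (auto simp: dessin_Aut_def BijGroup_def)
      then show ?thesis using that by (auto simp: compose_def m_assoc fun_eq_iff)
    qed
  qed
  moreover have "bij_betw ?L ?E (dessin_isos ?E ?x ?y ?E ?x ?y)"
    unfolding bij_betw_def
  proof
    show "inj_on ?L ?E"
    proof (rule inj_onI)
      fix g k assume gk: "g \<in> ?E" "k \<in> ?E" "?L g = ?L k"
      from gk(3) have "?L g \<one> = ?L k \<one>" by (rule fun_cong)
      then show "g = k" by (simp add: gk(1,2))
    qed
    show "?L ` ?E = dessin_isos ?E ?x ?y ?E ?x ?y"
    proof
      show "?L ` ?E \<subseteq> dessin_isos ?E ?x ?y ?E ?x ?y" using L by auto
      show "dessin_isos ?E ?x ?y ?E ?x ?y \<subseteq> ?L ` ?E"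
      proof
        fix f assume f: "f \<in> dessin_isos ?E ?x ?y ?E ?x ?y"
        then have f1: "f \<one> \<in> ?E" by (auto simp: dessin_isos_def dest: bij_betwE)
        have "f = ?L (f \<one>)"
          by (rule dessin_iso_eqI[OF D one_closed _ f L[OF f1] bij]) (use f1 in simp)
        then show "f \<in> ?L ` ?E" using f1 by blast
      qed
    qed
  qed
  ultimately have "?L \<in> iso G (dessin_Aut ?E ?x ?y)"
    by (auto simp: iso_def dessin_Aut_def)
  then show "dessin_Aut ?E ?x ?y \<cong> G"
    by (rule iso_sym[OF is_isoI])
qed

lemma regular_dessin_from_pair:
  assumes R: "regular_dessin E x y" and iso: "dessin_Aut E x y \<cong> G"
  obtains a b where "(a, b) \<in> generating_pairs G"
    and "dessin_isos (carrier G) (right_mult G a) (right_mult G b) E x y \<noteq> {}"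
proof -
  let ?A = "dessin_Aut E x y"
  have D: "dessin E x y" using R by (auto simp: regular_dessin_def)
  then have xy: "x \<in> Bij E" "y \<in> Bij E" and "E \<noteq> {}" by (auto simp: dessin_def)
  then obtain e0 where e0: "e0 \<in> E" by blast
  interpret A: group ?A using group_dessin_Aut(2)[OF xy] .
  have cA: "carrier ?A = dessin_isos E x y E x y" by (simp add: dessin_Aut_def)
  have AB: "f \<in> Bij E" if "f \<in> carrier ?A" for f
    using that dessin_isos_Bij cA by blast
  have mA: "(f \<otimes>\<^bsub>?A\<^esub> g) e = f (g e)" if "f \<in> carrier ?A" "g \<in> carrier ?A" "e \<in> E" for f g e
    using AB[OF that(1)] AB[OF that(2)] that(3) by (auto simp: dessin_Aut_def BijGroup_def compose_def)
  have Ax: "f (x e) = x (f e)" "f (y e) = y (f e)" if "f \<in> carrier ?A" "e \<in> E" for f e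
    using that by (auto simp: cA dessin_isos_def)
  have "x e0 \<in> E" "y e0 \<in> E" using xy e0 by (auto simp: Bij_in)
  then obtain a b where ab: "a \<in> carrier ?A" "a e0 = x e0" "b \<in> carrier ?A" "b e0 = y e0"
    using R e0 unfolding regular_dessin_def by metis
  have inj: "f = g" if "f \<in> carrier ?A" "g \<in> carrier ?A" "f e0 = g e0" for f g
    using dessin_iso_eqI[OF D e0] that xy cA by blast
  have gen: "generate ?A {a, b} = carrier ?A"
  proof
    let ?H = "generate ?A {a, b}"
    have sub: "subgroup ?H ?A" using ab by (intro A.generate_is_subgroup) auto
    show HA: "?H \<subseteq> carrier ?A" using sub by (rule subgroup.subset)
    have mem: "f \<in> ?H \<longleftrightarrow> f \<otimes>\<^bsub>?A\<^esub> c \<in> ?H" if "f \<in> carrier ?A" "c \<in> {a, b}" for f c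
    proof
      have c: "c \<in> ?H" "c \<in> carrier ?A" using that ab by (auto intro: generate.incl)
      show "f \<in> ?H \<Longrightarrow> f \<otimes>\<^bsub>?A\<^esub> c \<in> ?H" using sub c by (auto intro: subgroup.m_closed)
      assume "f \<otimes>\<^bsub>?A\<^esub> c \<in> ?H"
      then have "(f \<otimes>\<^bsub>?A\<^esub> c) \<otimes>\<^bsub>?A\<^esub> inv\<^bsub>?A\<^esub> c \<in> ?H"
        using sub c by (auto intro: subgroup.m_closed subgroup.m_inv_closed)
      then show "f \<in> ?H" using c that by (simp add: A.m_assoc)
    qed
    have P: "\<forall>f\<in>carrier ?A. f e0 = e \<longrightarrow> f \<in> ?H" if "e \<in> E" for e
    proof (rule dessin_orbit_induct[OF D e0 _ _ _ that, where P = "\<lambda>e. \<forall>f\<in>carrier ?A. f e0 = e \<longrightarrow> f \<in> ?H"])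
      have "\<one>\<^bsub>?A\<^esub> e0 = e0" using e0 by (simp add: dessin_Aut_def BijGroup_simps)
      then show "\<forall>f\<in>carrier ?A. f e0 = e0 \<longrightarrow> f \<in> ?H"
        using inj[OF _ A.one_closed] generate.one by metis
    next
      have *: "(\<forall>f\<in>carrier ?A. f e0 = e \<longrightarrow> f \<in> ?H) \<longleftrightarrow> (\<forall>f\<in>carrier ?A. f e0 = z e \<longrightarrow> f \<in> ?H)"
        if e: "e \<in> E" and z: "c \<in> {a, b}" "c e0 = z e0" "\<And>f. f \<in> carrier ?A \<Longrightarrow> f (z e0) = z (f e0)"
        for e c z
      proof -
        obtain f where f: "f \<in> carrier ?A" "f e0 = e"
          using R e0 e unfolding regular_dessin_def by metis
        have c: "c \<in> carrier ?A" using z ab by auto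
        have fc: "f \<otimes>\<^bsub>?A\<^esub> c \<in> carrier ?A" "(f \<otimes>\<^bsub>?A\<^esub> c) e0 = z e"
          using f c z e0 by (auto simp: mA)
        have "(\<forall>g\<in>carrier ?A. g e0 = e \<longrightarrow> g \<in> ?H) \<longleftrightarrow> f \<in> ?H"
          using f inj by metis
        moreover have "(\<forall>g\<in>carrier ?A. g e0 = z e \<longrightarrow> g \<in> ?H) \<longleftrightarrow> f \<otimes>\<^bsub>?A\<^esub> c \<in> ?H"
          using fc inj by metis
        ultimately show ?thesis using mem[OF f(1) z(1)] by simp
      qed
      show "(\<forall>f\<in>carrier ?A. f e0 = e \<longrightarrow> f \<in> ?H) \<longleftrightarrow> (\<forall>f\<in>carrier ?A. f e0 = x e \<longrightarrow> f \<in> ?H)" 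
        if "e \<in> E" for e using *[OF that, of a x] ab Ax(1)[OF _ e0] by blast
      show "(\<forall>f\<in>carrier ?A. f e0 = e \<longrightarrow> f \<in> ?H) \<longleftrightarrow> (\<forall>f\<in>carrier ?A. f e0 = y e \<longrightarrow> f \<in> ?H)" 
        if "e \<in> E" for e using *[OF that, of b y] ab Ax(2)[OF _ e0] by blast
    qed
    show "carrier ?A \<subseteq> ?H"
    proof
      fix f assume f: "f \<in> carrier ?A"
      then have "f e0 \<in> E" using AB e0 Bij_in by metis
      then show "f \<in> ?H" using P f by blast
    qed
  qed
  obtain i where i: "i \<in> iso ?A G" using iso by (auto simp: is_iso_def)
  then have ih: "i \<in> hom ?A G" and ib: "bij_betw i (carrier ?A) (carrier G)" by (auto simp: iso_def)
  interpret i: group_hom ?A G i using ih by unfold_locales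
  have pair: "(i a, i b) \<in> generating_pairs G"
    using i.generate_img[of "{a, b}"] ab gen ib by (auto simp: generating_pairs_def bij_betw_def)
  obtain j where j: "j \<in> iso G ?A" "\<And>f. f \<in> carrier ?A \<Longrightarrow> j (i f) = f"
    using A.iso_set_sym[OF i] ib by (metis bij_betw_inv_into_left)
  then have jh: "j \<in> hom G ?A" and jb: "bij_betw j (carrier G) (carrier ?A)" by (auto simp: iso_def)
  have jA: "j g \<in> carrier ?A" if "g \<in> carrier G" for g using jb that by (auto dest: bij_betwE)
  have ev: "bij_betw (\<lambda>f. f e0) (carrier ?A) E"
    unfolding bij_betw_def
  proof
    show "inj_on (\<lambda>f. f e0) (carrier ?A)" using inj by (auto intro: inj_onI)
    show "(\<lambda>f. f e0) ` carrier ?A = E"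
    proof
      show "(\<lambda>f. f e0) ` carrier ?A \<subseteq> E"
        using Bij_in[OF AB e0] by (rule image_subsetI)
      show "E \<subseteq> (\<lambda>f. f e0) ` carrier ?A"
      proof
        fix e assume "e \<in> E"
        then obtain f where "f \<in> carrier ?A" "f e0 = e"
          using R e0 unfolding regular_dessin_def by blast
        then show "e \<in> (\<lambda>f. f e0) ` carrier ?A" by (intro image_eqI[of _ _ f]) simp_all
      qed
    qed
  qed
  have "bij_betw (\<lambda>g. j g e0) (carrier G) E"
    using bij_betw_trans[OF jb ev] by (simp add: comp_def)
  moreover have "j (g \<otimes> i c) e0 = j g (c e0)" if "g \<in> carrier G" "c \<in> carrier ?A" for g c
    using that jA hom_mult[OF jh, of g "i c"] j(2) mA e0 by simp
  ultimately have "(\<lambda>g\<in>carrier G. j g e0) \<in>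
      dessin_isos (carrier G) (right_mult G (i a)) (right_mult G (i b)) E x y"
    using ab Ax[OF jA e0] by (auto simp: dessin_isos_def right_mult_def cong: bij_betw_cong)
  with pair that show thesis by blast
qed

lemma pair_dessins_iso_iff:
  assumes ab: "(a, b) \<in> generating_pairs G" and cd: "(c, d) \<in> generating_pairs G"
  shows "dessin_isos (carrier G) (right_mult G a) (right_mult G b)
           (carrier G) (right_mult G c) (right_mult G d) \<noteq> {}
         \<longleftrightarrow> (c, d) \<in> orbit (AutoGroup G) (\<lambda>f. map_prod f f) (a, b)"
    (is "?D \<noteq> {} \<longleftrightarrow> _")
proof
  have ab': "a \<in> carrier G" "b \<in> carrier G" "generate G {a, b} = carrier G"
    and cd': "c \<in> carrier G" "d \<in> carrier G"
    using ab cd by (auto simp: generating_pairs_def)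
  {
    assume "?D \<noteq> {}"
    then obtain f where f: "f \<in> ?D" by blast
    then have f1: "f \<one> \<in> carrier G" by (auto simp: dessin_isos_def dest: bij_betwE)
    define s where "s = compose (carrier G) (\<lambda>h\<in>carrier G. inv (f \<one>) \<otimes> h) f"
    have s: "s \<in> ?D"
      unfolding s_def using f1 ab' cd'
      by (intro dessin_isos_compose[OF f left_mult_iso] right_mult_Bij) auto
    have s1: "s \<one> = \<one>" using f1 by (simp add: s_def compose_def)
    have sc: "s g \<in> carrier G" if "g \<in> carrier G" for g
      using s that by (auto simp: dessin_isos_def dest: bij_betwE)
    have sa: "s (g \<otimes> a) = s g \<otimes> c" "s (g \<otimes> b) = s g \<otimes> d" if "g \<in> carrier G" for g
      using s that sc[OF that] by (auto simp: dessin_isos_def right_mult_def)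
    have sab: "s a = c" "s b = d" using sa[of \<one>] s1 ab' cd' by auto
    have "\<forall>g\<in>carrier G. s (g \<otimes> h) = s g \<otimes> s h" if "h \<in> generate G {a, b}" for h
      using that
    proof induction
      case one
      then show ?case using s1 sc by simp
    next
      case (incl h)
      then show ?case using sa sab by auto
    next
      case (inv h)
      then have h: "h \<in> carrier G" "\<And>g. g \<in> carrier G \<Longrightarrow> s (g \<otimes> h) = s g \<otimes> s h"
        using ab' sa sab by auto
      have *: "s (g \<otimes> inv h) = s g \<otimes> inv (s h)" if "g \<in> carrier G" for g
        using h(2)[of "g \<otimes> inv h"] that h(1) sc by (simp add: m_assoc inv_solve_right)
      show ?case using * *[of \<one>] s1 sc h(1) by simp
    next
      case (eng h k)
      then have "h \<in> carrier G" "k \<in> carrier G" using generate_in_carrier[of "{a, b}"] ab' by auto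
      then show ?case using eng.IH sc by (simp add: m_assoc[symmetric])
    qed
    then have "s \<in> auto G"
      using s sc ab'(3) by (auto simp: auto_def hom_def Bij_def dessin_isos_def)
    then show "(c, d) \<in> orbit (AutoGroup G) (\<lambda>f. map_prod f f) (a, b)"
      using sab by (force simp: orbit_def AutoGroup_def)
  next
    assume "(c, d) \<in> orbit (AutoGroup G) (\<lambda>f. map_prod f f) (a, b)"
    then obtain s where s: "s \<in> auto G" "s a = c" "s b = d"
      by (auto simp: orbit_def AutoGroup_def)
    then have "s \<in> ?D"
      using ab' by (auto simp: auto_def Bij_def dessin_isos_def right_mult_def hom_def dest: bij_betwE)
    then show "?D \<noteq> {}" by blast
  }
qed

text \<open>
  Taking the edges in the type of the group elements loses nothing: by
  \<open>regular_dessin_from_pair\<close>, a regular dessin over any edge type whose automorphism group is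
  isomorphic to \<open>G\<close> is isomorphic to one whose set of edges is \<open>carrier G\<close>.
\<close>

theorem determines_unique_regular_dessin_iff:
  assumes fin: "finite (carrier G)"
  shows "determines_unique_regular_dessin G \<longleftrightarrow>
    (\<exists>(E :: 'a set) x y. regular_dessin E x y \<and> dessin_Aut E x y \<cong> G) \<and>
    (\<forall>(E :: 'a set) x y (E' :: 'a set) x' y'.
       regular_dessin E x y \<and> dessin_Aut E x y \<cong> G \<and>
       regular_dessin E' x' y' \<and> dessin_Aut E' x' y' \<cong> G \<longrightarrow>
       dessin_isos E x y E' x' y' \<noteq> {})"
    (is "_ \<longleftrightarrow> ?ex \<and> ?uniq")
proof
  let ?P = "generating_pairs G" and ?orb = "orbit (AutoGroup G) (\<lambda>f. map_prod f f)"
  note pb = right_mult_Bij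
  have refl: "p \<in> ?orb p" if "p \<in> ?P" for p
  proof -
    obtain a b where p: "p = (a, b)" "a \<in> carrier G" "b \<in> carrier G"
      using \<open>p \<in> ?P\<close> by (auto simp: generating_pairs_def)
    have "map_prod (\<lambda>x\<in>carrier G. x) (\<lambda>x\<in>carrier G. x) (a, b) = (a, b)" using p by simp
    then have "(a, b) \<in> ?orb (a, b)"
      unfolding orbit_def using id_in_auto
      by (intro CollectI exI[of _ "\<lambda>x\<in>carrier G. x"]) (auto simp: AutoGroup_def)
    then show ?thesis by (simp add: p)
  qed
  {
    assume "determines_unique_regular_dessin G"
    then obtain O1 where "orbits (AutoGroup G) ?P (\<lambda>f. map_prod f f) = {O1}"
      by (auto simp: determines_unique_regular_dessin_def card_1_singleton_iff)
    then have O1: "\<And>p. p \<in> ?P \<Longrightarrow> ?orb p = O1" and "?P \<noteq> {}" by (auto simp: orbits_def)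
    then obtain a b where ab: "(a, b) \<in> ?P" by auto
    have ?ex using generating_pair_dessin[OF fin ab] by blast
    moreover have "dessin_isos E x y E' x' y' \<noteq> {}"
      if R: "regular_dessin E x y" "dessin_Aut E x y \<cong> G"
        and R': "regular_dessin E' x' y'" "dessin_Aut E' x' y' \<cong> G"
      for E x y E' x' y'
    proof -
      obtain a b f where ab: "(a, b) \<in> ?P"
        and f: "f \<in> dessin_isos (carrier G) (right_mult G a) (right_mult G b) E x y"
        using regular_dessin_from_pair[OF R] by (metis all_not_in_conv)
      obtain c d g where cd: "(c, d) \<in> ?P"
        and g: "g \<in> dessin_isos (carrier G) (right_mult G c) (right_mult G d) E' x' y'"
        using regular_dessin_from_pair[OF R'] by (metis all_not_in_conv)
      have "(c, d) \<in> ?orb (a, b)" using O1 refl ab cd by metis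
      then obtain h where h: "h \<in> dessin_isos (carrier G) (right_mult G a) (right_mult G b)
           (carrier G) (right_mult G c) (right_mult G d)"
        using pair_dessins_iso_iff[OF ab cd] by blast
      have in_G: "a \<in> carrier G" "b \<in> carrier G" using ab by (auto simp: generating_pairs_def)
      have xy: "x \<in> Bij E" "y \<in> Bij E" using R by (auto simp: regular_dessin_def dessin_def)
      show ?thesis
        using dessin_isos_compose[OF dessin_isos_inv[OF f] dessin_isos_compose[OF h g] xy]
          in_G pb by blast
    qed
    ultimately show "?ex \<and> ?uniq" by blast
  next
    assume *: "?ex \<and> ?uniq"
    then obtain E :: "'a set" and x y where "regular_dessin E x y" "dessin_Aut E x y \<cong> G" by blast
    then obtain a b where ab: "(a, b) \<in> ?P" using regular_dessin_from_pair by metis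
    have sub: "q \<in> ?orb p" if "p \<in> ?P" "q \<in> ?P" for p q
    proof -
      obtain a b c d where "p = (a, b)" "q = (c, d)" by (metis surj_pair)
      then show ?thesis
        using * generating_pair_dessin[OF fin] pair_dessins_iso_iff that by simp
    qed
    have "?orb p = ?P" if p: "p \<in> ?P" for p
    proof
      show "?P \<subseteq> ?orb p" using sub p by blast
      show "?orb p \<subseteq> ?P"
      proof
        fix q assume "q \<in> ?orb p"
        then obtain s where s: "s \<in> auto G" "q = map_prod s s p"
          by (auto simp: orbit_def AutoGroup_def)
        obtain a b where ab: "p = (a, b)" "a \<in> carrier G" "b \<in> carrier G" "generate G {a, b} = carrier G"
          using p by (auto simp: generating_pairs_def)
        interpret s: group_hom G G s using s by unfold_locales (auto simp: auto_def)
        have "s ` carrier G = carrier G" using s by (auto simp: auto_def Bij_def bij_betw_def)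
        then show "q \<in> ?P"
          using s.generate_img[of "{a, b}"] ab s by (auto simp: generating_pairs_def)
      qed
    qed
    then have "orbits (AutoGroup G) ?P (\<lambda>f. map_prod f f) = {?P}"
      using ab unfolding orbits_def by (intro equalityI subsetI) (auto, metis)
    then show "determines_unique_regular_dessin G"
      by (simp add: determines_unique_regular_dessin_def)
  }
qed

end

end

theory Submission
  imports Defs
begin

text \<open>
  Two numbers are compared: the order of the automorphism group and the number of generating
  pairs. An automorphism is determined by its values on a generating pair, so the automorphism group
  acts freely on the generating pairs and every orbit has as many elements as there are
  automorphisms. Hence there is a single orbit exactly when there are as many automorphisms as
  generating pairs (\<open>determines_unique_iff_card_auto\<close>), and it remains to see that the number of
  generating pairs of a non-cyclic two-generator group of order \<open>p ^ n\<close> is Hall's bound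
  (\<open>card_generating_pairs\<close>).

  For the count, every proper subgroup of a \<open>p\<close>-group lies in a normal subgroup of index \<open>p\<close>
  (\<open>proper_subgroup_le_prime_index_normal\<close>, because normalizers grow in \<open>p\<close>-groups). So two
  elements generate the group exactly when no subgroup of this kind contains both. Let \<open>\<Phi>\<close> be the
  intersection of all of them, the Frattini subgroup. The quotient by \<open>\<Phi>\<close> is abelian of exponent
  \<open>p\<close> and generated by two elements, so \<open>\<Phi>\<close> has index at most \<open>p\<^sup>2\<close>; the intersection of any two
  distinct normal subgroups of index \<open>p\<close> has index at least \<open>p\<^sup>2\<close> and contains \<open>\<Phi>\<close>, so it is
  \<open>\<Phi>\<close> (\<open>prime_index_normals_Int\<close>). As the group is not cyclic, every element lies in some subgroup of
  index \<open>p\<close>, and an element outside \<open>\<Phi>\<close> therefore in exactly one. A generating pair is then chosen by taking its first component anywhere outside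
  \<open>\<Phi>\<close> and its second anywhere outside the one index-\<open>p\<close> subgroup containing the first; this gives
  \<open>(p ^ n - p ^ (n - 2)) * (p ^ n - p ^ (n - 1))\<close> pairs.
\<close>

section \<open>Fixed points of p-group actions\<close>

lemma prime_dvd_if_dvd_power:
  assumes p: "Factorial_Ring.prime (p::nat)" and k: "k dvd p ^ n" "k \<noteq> 1"
  shows "p dvd k"
proof -
  obtain i where i: "k = p ^ i" using k p by (auto simp: divides_primepow_nat)
  then show ?thesis using k(2) by (cases i) auto
qed

text \<open>
  The points moved by some group element form a union of non-trivial orbits, whose lengths divide
  the order of the group. Consequently the number of fixed points is congruent modulo \<open>p\<close> to the
  size of the set.
\<close>

lemma (in group_action) prime_power_order_dvd_card_nonfixed:
  assumes p: "Factorial_Ring.prime (p::nat)" and ord: "order G = p ^ n" and fin: "finite E"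
  shows "p dvd card {x \<in> E. \<exists>g\<in>carrier G. \<phi> g x \<noteq> x}"
proof -
  let ?U = "{x \<in> E. \<exists>g\<in>carrier G. \<phi> g x \<noteq> x}"
  define f :: "_ \<Rightarrow> nat" where "f = (\<lambda>x. if x \<in> ?U then 1 else 0)"
  interpret group G using group_hom by (rule group_hom.axioms)
  have "card ?U = (\<Sum>x\<in>E. f x)"
    using fin by (simp add: f_def sum.If_cases Int_def)
  also have "\<dots> = (\<Sum>orb\<in>orbits G E \<phi>. \<Sum>x\<in>orb. f x)"
    by (rule disjoint_sum[OF fin, symmetric])
  also have "p dvd \<dots>"
  proof (rule dvd_sum)
    fix orb assume orb: "orb \<in> orbits G E \<phi>"
    show "p dvd (\<Sum>x\<in>orb. f x)"
    proof (cases "\<exists>x\<in>orb. x \<in> ?U")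
      case False
      then have "(\<Sum>x\<in>orb. f x) = 0" by (intro sum.neutral) (auto simp: f_def)
      then show ?thesis by simp
    next
      case True
      then obtain x where x: "x \<in> orb" "x \<in> ?U" by blast
      have orbE: "orb \<subseteq> E" using orbits_coverture orb by blast
      obtain z where z: "z \<in> E" "orb = orbit G \<phi> z" using orb by (auto simp: orbits_def)
      have eq: "orb = orbit G \<phi> y" if "y \<in> orb" for y
      proof -
        have "y \<in> E" using that orbE by blast
        then have "orbit G \<phi> y \<in> orbits G E \<phi>" "y \<in> orbit G \<phi> y"
          using orbit_refl by (auto simp: orbits_def)
        then show ?thesis using disjoint_union[OF orb] that by blast
      qed
      obtain g where g: "g \<in> carrier G" "\<phi> g x \<noteq> x" using x by blast
      have gx: "\<phi> g x \<in> orb" using eq[OF x(1)] g by (auto simp: orbit_def)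
      have "orb \<subseteq> ?U"
      proof
        fix y assume y: "y \<in> orb"
        show "y \<in> ?U"
        proof (rule ccontr)
          assume "y \<notin> ?U"
          then have "orbit G \<phi> y \<subseteq> {y}" using y orbE by (auto simp: orbit_def)
          then show False using eq[OF y] x(1) gx g(2) by blast
        qed
      qed
      then have "(\<Sum>x\<in>orb. f x) = (\<Sum>x\<in>orb. 1)" by (intro sum.cong) (auto simp: f_def)
      then have "(\<Sum>x\<in>orb. f x) = card orb" by simp
      moreover have "card orb dvd p ^ n"
        using orbit_stabilizer_theorem[OF z(1)] ord z(2) by (metis dvd_triv_left)
      moreover have "card orb \<noteq> 1"
        using x(1) gx g(2) by (metis card_1_singletonE singletonD)
      ultimately show ?thesis
        using prime_dvd_if_dvd_power[OF p, of "card orb" n] by simp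
    qed
  qed
  finally show ?thesis .
qed

context group
begin

lemma finite_carrier_if_order_prime_power:
  assumes "Factorial_Ring.prime (p::nat)" and "order G = p ^ n"
  shows "finite (carrier G)"
  using assms by (metis order_gt_0_iff_finite prime_gt_0_nat zero_less_power)

text \<open>
  Right multiplication by the inverse turns right cosets into a left action of \<open>H\<close>. A coset
  \<open>H #> x\<close> is fixed iff conjugation by \<open>x\<close> maps \<open>H\<close> into itself, so that for finite \<open>H\<close> this action
  detects the normalizer.
\<close>

lemma right_coset_action:
  assumes H: "subgroup H G"
  shows "group_action (G\<lparr>carrier := H\<rparr>) (rcosets H) (\<lambda>h. \<lambda>R\<in>rcosets H. R #> inv h)"
proof -
  have sub: "H \<subseteq> carrier G" using H by (rule subgroup.subset)
  have RG: "R \<subseteq> carrier G" if "R \<in> rcosets H" for R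
    using that H rcosets_subset_PowG by blast
  have mem: "R #> g \<in> rcosets H" if "R \<in> rcosets H" "g \<in> carrier G" for R g
    using that sub by (auto simp: RCOSETS_def coset_mult_assoc)
  have act: "(R #> g) #> h = R #> (g \<otimes> h)" if "R \<in> rcosets H" "g \<in> carrier G" "h \<in> carrier G" for R g h
    using that RG by (simp add: coset_mult_assoc)
  have one: "R #> \<one> = R" if "R \<in> rcosets H" for R using RG that by simp
  have B: "(\<lambda>R\<in>rcosets H. R #> inv h) \<in> Bij (rcosets H)" if "h \<in> H" for h
  proof -
    have h: "h \<in> carrier G" using that sub by blast
    have "bij_betw (\<lambda>R. R #> inv h) (rcosets H) (rcosets H)"
      by (rule bij_betw_byWitness[where f' = "\<lambda>R. R #> h"])
         (use h in \<open>auto simp: act one mem\<close>)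
    then show ?thesis by (auto simp: Bij_def cong: bij_betw_cong)
  qed
  show ?thesis
    unfolding group_action_def
  proof (intro group_hom.intro group_BijGroup group_hom_axioms.intro homI)
    show "group (G\<lparr>carrier := H\<rparr>)" using subgroup_imp_group[OF H] .
    show "(\<lambda>R\<in>rcosets H. R #> inv h) \<in> carrier (BijGroup (rcosets H))"
      if "h \<in> carrier (G\<lparr>carrier := H\<rparr>)" for h
      using B that by (simp add: BijGroup_simps)
    fix g h assume "g \<in> carrier (G\<lparr>carrier := H\<rparr>)" "h \<in> carrier (G\<lparr>carrier := H\<rparr>)"
    then have gh: "g \<in> H" "h \<in> H" "g \<in> carrier G" "h \<in> carrier G" using sub by auto
    show "(\<lambda>R\<in>rcosets H. R #> inv (g \<otimes>\<^bsub>G\<lparr>carrier := H\<rparr>\<^esub> h)) =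
      (\<lambda>R\<in>rcosets H. R #> inv g) \<otimes>\<^bsub>BijGroup (rcosets H)\<^esub> (\<lambda>R\<in>rcosets H. R #> inv h)"
      using gh by (auto simp: BijGroup_simps(2)[OF B B] compose_def fun_eq_iff act mem inv_mult_group)
  qed
qed

section \<open>Normalizers and subgroups of index p\<close>

text \<open>
  Let \<open>H\<close> act on its right cosets. Their number is divisible by \<open>p\<close>, hence so is the number of
  fixed cosets; as \<open>H\<close> itself is fixed there is another one, and its representatives normalize
  \<open>H\<close> without lying in it.
\<close>

lemma proper_subgroup_less_normalizer:
  assumes p: "Factorial_Ring.prime (p::nat)" and ord: "order G = p ^ n"
    and H: "subgroup H G" and proper: "H \<noteq> carrier G"
  shows "H \<subset> normalizer G H"
proof -
  note fin = finite_carrier_if_order_prime_power[OF p ord]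
  have sub: "H \<subseteq> carrier G" using H by (rule subgroup.subset)
  interpret A: group_action "G\<lparr>carrier := H\<rparr>" "rcosets H" "\<lambda>h. \<lambda>R\<in>rcosets H. R #> inv h"
    using right_coset_action[OF H] .
  have lag: "card (rcosets H) * card H = p ^ n" using lagrange[OF H] ord by simp
  then obtain k where k: "card H = p ^ k"
    using p by (metis divides_primepow_nat dvd_triv_right)
  let ?U = "{R \<in> rcosets H. \<exists>h\<in>carrier (G\<lparr>carrier := H\<rparr>). (\<lambda>R\<in>rcosets H. R #> inv h) R \<noteq> R}"
  let ?F = "{R \<in> rcosets H. \<forall>h\<in>H. R #> inv h = R}"
  have finR: "finite (rcosets H)"
    using fin rcosets_subset_PowG[OF H] by (meson finite_Pow_iff finite_subset)
  have U: "p dvd card ?U"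
    by (rule A.prime_power_order_dvd_card_nonfixed[OF p _ finR, of k]) (simp add: order_def k)
  have "card (?U \<union> ?F) = card ?U + card ?F"
    by (rule card_Un_disjoint) (use finR in auto)
  moreover have "?U \<union> ?F = rcosets H" by auto
  moreover have "p dvd card (rcosets H)"
  proof -
    have "card (rcosets H) dvd p ^ n" unfolding lag[symmetric] by (rule dvd_triv_left)
    moreover have "card (rcosets H) \<noteq> 1"
    proof
      assume "card (rcosets H) = 1"
      then have "card H = card (carrier G)" using lagrange[OF H] by (simp add: order_def)
      then show False using card_subset_eq[OF fin sub] proper by simp
    qed
    ultimately show ?thesis
      using prime_dvd_if_dvd_power[OF p] by blast
  qed
  ultimately have dF: "p dvd card ?F" using U dvd_add_right_iff[of p "card ?U" "card ?F"] by simp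
  have HF: "H \<in> ?F"
  proof (intro CollectI conjI ballI)
    show "H \<in> rcosets H" by (rule subgroup.subgroup_in_rcosets[OF H is_group])
    show "H #> inv h = H" if "h \<in> H" for h
      using that sub by (intro coset_join2 H subgroup.m_inv_closed[OF H]) auto
  qed
  have "?F \<noteq> {H}"
    using dF p by (metis One_nat_def card_1_singleton_iff not_prime_unit)
  then obtain R where R: "R \<in> ?F" "R \<noteq> H" using HF by blast
  then obtain x where x: "x \<in> carrier G" "R = H #> x" by (auto simp: RCOSETS_def)
  have "x <# H #> inv x \<subseteq> H"
  proof
    fix y assume "y \<in> x <# H #> inv x"
    then obtain h where h: "h \<in> H" "y = x \<otimes> h \<otimes> inv x"
      by (auto simp: l_coset_def r_coset_def)
    then have hG: "h \<in> carrier G" using sub by blast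
    have "R #> inv (inv h) = R" using R H h by (blast intro: subgroup.m_inv_closed)
    then have "H #> (x \<otimes> h) = H #> x" using x hG sub by (simp add: coset_mult_assoc)
    then have "x \<otimes> h \<in> H #> x" using rcos_self[OF _ H, of "x \<otimes> h"] x hG by simp
    then show "y \<in> H"
      using subgroup.rcos_module_imp[OF H is_group x(1)] h by blast
  qed
  moreover have "card (x <# H #> inv x) = card H"
  proof -
    have "x <# H #> inv x = (\<lambda>h. x \<otimes> h \<otimes> inv x) ` H"
      by (auto simp: l_coset_def r_coset_def)
    moreover have "inj_on (\<lambda>h. x \<otimes> h \<otimes> inv x) H"
      using conjugation_is_inj[OF x(1)] sub by (intro inj_onI) blast
    ultimately show ?thesis by (simp add: card_image)
  qed
  ultimately have "x <# H #> inv x = H"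
    using finite_subset[OF sub fin] by (simp add: card_subset_eq)
  then have "x \<in> normalizer G H" using x(1) sub by (simp add: normalizer_def stabilizer_def)
  moreover have "x \<notin> H" using R x coset_join2[OF x(1) H] by blast
  moreover have "H \<subseteq> normalizer G H"
    using subgroup.subset[OF normal_imp_subgroup[OF subgroup_in_normalizer[OF H]]] by simp
  ultimately show ?thesis by blast
qed

text \<open>
  In a \<open>p\<close>-group these are exactly the maximal subgroups. Their normality and index are put into
  the definition because these are the properties that get used; that there are enough of them is
  \<open>proper_subgroup_le_prime_index_normal\<close>.
\<close>

definition prime_index_normals :: "nat \<Rightarrow> 'a set set" where
  "prime_index_normals p = {M. M \<lhd> G \<and> card M * p = order G}"

text \<open>
  A maximal proper subgroup \<open>M\<close> above \<open>H\<close> is normal, since its normalizer is strictly larger. By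
  Sylow's theorem \<open>G Mod M\<close> has a subgroup of order \<open>p\<close>; its preimage properly contains \<open>M\<close>, so
  it is \<open>G\<close> and the index of \<open>M\<close> is \<open>p\<close>.
\<close>

lemma proper_subgroup_le_prime_index_normal:
  assumes p: "Factorial_Ring.prime (p::nat)" and ord: "order G = p ^ n"
    and H: "subgroup H G" and proper: "H \<noteq> carrier G"
  obtains M where "M \<in> prime_index_normals p" "H \<subseteq> M"
proof -
  note fin = finite_carrier_if_order_prime_power[OF p ord]
  let ?S = "{M. subgroup M G \<and> H \<subseteq> M \<and> M \<noteq> carrier G}"
  have "finite ?S"
    by (rule finite_subset[of _ "Pow (carrier G)"]) (use fin subgroup.subset in auto)
  moreover have "H \<in> ?S" using H proper by simp
  ultimately obtain M where M: "M \<in> ?S" and max: "\<And>K. K \<in> ?S \<Longrightarrow> M \<subseteq> K \<Longrightarrow> K = M"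
    using finite_has_maximal[of ?S] by (metis (no_types, lifting) empty_iff)
  have MG: "subgroup M G" "M \<subseteq> carrier G" and HM: "H \<subseteq> M" using M subgroup.subset by auto
  have full: "K = carrier G" if "subgroup K G" "M \<subseteq> K" "K \<noteq> M" for K
    using max[of K] that HM by blast
  have norm: "M \<lhd> G"
  proof -
    have "M \<subset> normalizer G M"
      using proper_subgroup_less_normalizer[OF p ord MG(1)] M by blast
    then have "normalizer G M = carrier G"
      using full normalizer_imp_subgroup[OF MG(2)] by blast
    then show ?thesis using subgroup_in_normalizer[OF MG(1)] by simp
  qed
  interpret M: normal M G by (rule norm)
  interpret Q: group "G Mod M" by (rule M.factorgroup_is_group)
  have lag: "card (rcosets M) * card M = p ^ n" using lagrange[OF MG(1)] ord by simp
  obtain k where k: "card (rcosets M) = p ^ k"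
    using p lag by (metis divides_primepow_nat dvd_triv_left)
  have oQ: "order (G Mod M) = p ^ k" using k by (simp add: order_def FactGroup_def)
  have cM: "card M \<noteq> card (carrier G)" using M card_subset_eq[OF fin MG(2)] by blast
  then have "k \<noteq> 0" using lag k ord by (intro notI) (simp add: order_def)
  then obtain j where j: "k = Suc j" using not0_implies_Suc by blast
  obtain K where K: "subgroup K (G Mod M)" "card K = p ^ 1"
    using sylow_thm[OF p Q.is_group, of 1 "p ^ j"] oQ j p fin Q.order_gt_0_iff_finite
    by (metis power_one_right power_Suc prime_gt_0_nat zero_less_power)
  have KQ: "K \<subseteq> rcosets M" using subgroup.subset[OF K(1)] by (simp add: FactGroup_def)
  let ?P = "{g \<in> carrier G. M #> g \<in> K}"
  interpret h: group_hom G "G Mod M" "\<lambda>g. M #> g"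
    using M.r_coset_hom_Mod by unfold_locales
  have Psub: "subgroup ?P G"
  proof (rule subgroupI)
    have "M #> \<one> \<in> K" using subgroup.one_closed[OF K(1)] MG(2) by simp
    then show "?P \<noteq> {}" by blast
    show "inv a \<in> ?P" if "a \<in> ?P" for a
      using that h.hom_inv[of a] subgroup.m_inv_closed[OF K(1)] by simp
    show "a \<otimes> b \<in> ?P" if "a \<in> ?P" "b \<in> ?P" for a b
      using that h.hom_mult[of a b] subgroup.m_closed[OF K(1)] by simp
  qed auto
  have "M \<subseteq> ?P" using M.rcos_const[OF is_group] subgroup.one_closed[OF K(1)] MG by auto
  moreover have "?P \<noteq> M"
  proof
    assume PM: "?P = M"
    have "K \<subseteq> {M}"
    proof
      fix R assume R: "R \<in> K"
      then obtain x where x: "x \<in> carrier G" "R = M #> x" using KQ by (auto simp: RCOSETS_def)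
      then have "x \<in> M" using R PM by blast
      then show "R \<in> {M}" using x M.rcos_const[OF is_group] by simp
    qed
    then have "card K \<le> 1" by (metis card.empty card_1_singleton_iff le_eq_less_or_eq One_nat_def subset_singletonD zero_le_one)
    then show False using K(2) prime_gt_1_nat[OF p] by simp
  qed
  ultimately have P: "?P = carrier G" using full Psub by blast
  have "rcosets M \<subseteq> K" using P by (auto simp: RCOSETS_def)
  then have "card (rcosets M) = p" using KQ K(2) by simp
  then have "card M * p = order G" using lag ord by (simp add: mult.commute)
  then show thesis using that[of M] norm HM by (simp add: prime_index_normals_def)
qed

lemma prime_order_imp_comm_group:
  assumes p: "Factorial_Ring.prime (p::nat)" and ord: "order G = p"
  shows "comm_group G"
proof -
  have fin: "finite (carrier G)" using p ord by (metis order_gt_0_iff_finite prime_gt_0_nat)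
  have "carrier G \<noteq> {\<one>}" using p ord by (metis order_one_triv_iff not_prime_1)
  then obtain x where x: "x \<in> carrier G" "x \<noteq> \<one>" using one_closed by blast
  let ?X = "generate G {x}"
  have X: "subgroup ?X G" using x by (intro generate_is_subgroup) simp
  have "x \<in> ?X" by (simp add: generate.incl)
  then have "?X \<noteq> {\<one>}" using x by blast
  moreover have "\<one> \<in> ?X" by (rule generate.one)
  ultimately have "card ?X \<noteq> 1" by (metis card_1_singleton_iff One_nat_def singletonD)
  moreover have "card ?X dvd p" using lagrange[OF X] ord by (metis dvd_triv_right)
  ultimately have "card ?X = card (carrier G)"
    using p ord by (auto simp: order_def prime_nat_iff)
  then have "?X = carrier G" using card_subset_eq[OF fin subgroup.subset[OF X]] by simp
  then have "subgroup_generated G {x} = G"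
    using x by (simp add: subgroup_generated_def)
  then have "cyclic_group G" using x(1) unfolding cyclic_group_def by blast
  then show ?thesis by (rule cyclic_imp_abelian_group)
qed

text \<open>
  The quotient has order \<open>p\<close>, so it is abelian and its elements have order dividing \<open>p\<close>.
\<close>

lemma
  assumes p: "Factorial_Ring.prime (p::nat)" and fin: "finite (carrier G)"
    and M: "M \<in> prime_index_normals p"
  shows derived_le_prime_index_normal: "derived G (carrier G) \<subseteq> M"
    and pow_in_prime_index_normal: "\<And>x. x \<in> carrier G \<Longrightarrow> x [^] p \<in> M"
proof -
  interpret M: normal M G using M by (simp add: prime_index_normals_def)
  interpret Q: group "G Mod M" by (rule M.factorgroup_is_group)
  have sub: "subgroup M G" by (rule M.subgroup_axioms)
  have "card (rcosets M) * card M = p * card M"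
    using lagrange[OF sub] M by (simp add: prime_index_normals_def mult.commute)
  moreover have "card M > 0"
    using finite_subset[OF M.subset fin] subgroup.one_closed[OF sub]
    unfolding card_gt_0_iff by blast
  ultimately have oQ: "order (G Mod M) = p" by (simp add: order_def FactGroup_def)
  show "derived G (carrier G) \<subseteq> M"
    using derived_minimal[OF M.normal_axioms] Q.prime_order_imp_comm_group[OF p oQ] by blast
  fix x assume x: "x \<in> carrier G"
  then have "M #> x \<in> carrier (G Mod M)" using M.subset by (auto simp: FactGroup_def intro: rcosetsI)
  then have "(M #> x) [^]\<^bsub>G Mod M\<^esub> p = M"
    using Q.pow_order_eq_1 oQ by simp
  then have "M #> (x [^] p) = M" using M.FactGroup_pow[OF x] by simp
  then show "x [^] p \<in> M" using coset_join1 x sub by simp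
qed

text \<open>
  Conjugation changes an element only by a commutator factor.
\<close>

lemma derived_le_imp_normal:
  assumes N: "subgroup N G" and D: "derived G (carrier G) \<subseteq> N"
  shows "N \<lhd> G"
proof (rule normal_invI[OF N])
  fix x h assume x: "x \<in> carrier G" and h: "h \<in> N"
  have hG: "h \<in> carrier G" using h subgroup.subset[OF N] by blast
  have "x \<otimes> h \<otimes> inv x \<otimes> inv h \<in> derived G (carrier G)"
    unfolding derived_def using x hG by (intro generate.incl) blast
  then have "(x \<otimes> h \<otimes> inv x \<otimes> inv h) \<otimes> h \<in> N" using D h subgroup.m_closed[OF N] by blast
  then show "x \<otimes> h \<otimes> inv x \<in> N" using x hG by (simp add: m_assoc)
qed

text \<open>
  Modulo \<open>N\<close> only the exponents of \<open>x\<close> below \<open>p\<close> matter, so \<open>p\<close> cosets of \<open>N\<close> cover the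
  product.
\<close>

lemma card_normal_mult_cyclic_le:
  assumes N: "N \<lhd> G" and fin: "finite (carrier G)" and x: "x \<in> carrier G"
    and p: "p > 0" and xp: "x [^] (p::nat) \<in> N"
  shows "card (N <#> generate G {x}) \<le> p * card N"
proof -
  have sub: "subgroup N G" "N \<subseteq> carrier G"
    using N by (auto simp: normal_imp_subgroup subgroup.subset)
  have "N <#> generate G {x} \<subseteq> (\<Union>i<p. N #> (x [^] i))"
  proof
    fix y assume "y \<in> N <#> generate G {x}"
    then obtain m k where y: "m \<in> N" "y = m \<otimes> x [^] (k::int)"
      using x by (auto simp: set_mult_def generate_pow)
    define i where "i = nat (k mod int p)"
    have i: "i < p" "k = int p * (k div int p) + int i"
      using p by (auto simp: i_def nat_less_iff)
    have mG: "m \<in> carrier G" using y sub by blast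
    have "x [^] k = (x [^] p) [^] (k div int p) \<otimes> x [^] i"
    proof -
      have "x [^] k = x [^] (int p * (k div int p)) \<otimes> x [^] int i"
        using x by (metis i(2) int_pow_mult)
      also have "x [^] (int p * (k div int p)) = (x [^] int p) [^] (k div int p)"
        using x by (simp add: int_pow_pow)
      finally show ?thesis by (simp add: int_pow_int)
    qed
    moreover have "(x [^] p) [^] (k div int p) \<in> N"
      using subgroup_int_pow_closed[OF sub(1) xp] .
    ultimately have "y = (m \<otimes> (x [^] p) [^] (k div int p)) \<otimes> x [^] i"
      "m \<otimes> (x [^] p) [^] (k div int p) \<in> N"
      using y mG x subgroup.m_closed[OF sub(1)] by (simp_all add: m_assoc)
    then show "y \<in> (\<Union>i<p. N #> (x [^] i))" using i(1) unfolding r_coset_def by blast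
  qed
  then have "card (N <#> generate G {x}) \<le> card (\<Union>i<p. N #> (x [^] i))"
    using finite_subset[OF sub(2) fin] by (intro card_mono) (auto simp: r_coset_def)
  also have "\<dots> \<le> (\<Sum>i<p. card (N #> (x [^] i)))" by (rule card_UN_le) simp
  also have "\<dots> = (\<Sum>i<p. card N)"
    using x sub by (intro sum.cong refl card_rcosets_equal[symmetric] rcosetsI) auto
  finally show ?thesis by simp
qed

text \<open>
  Adjoining to \<open>D\<close> first \<open>a\<close> and then \<open>b\<close> multiplies the cardinality by at most \<open>p\<close> each time and
  ends with the whole group. Every subgroup above \<open>D\<close> contains the commutators, so it is normal and
  the second step works like the first.
\<close>

lemma order_le_of_two_generators:
  assumes fin: "finite (carrier G)" and p: "p > 0"
    and ab: "a \<in> carrier G" "b \<in> carrier G" "generate G {a, b} = carrier G"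
    and D: "subgroup D G" "derived G (carrier G) \<subseteq> D"
    and pow: "\<And>x. x \<in> carrier G \<Longrightarrow> x [^] (p::nat) \<in> D"
  shows "order G \<le> p\<^sup>2 * card D"
proof -
  have extend: "\<exists>F. subgroup F G \<and> E \<subseteq> F \<and> x \<in> F \<and> card F \<le> p * card E"
    if E: "subgroup E G" "D \<subseteq> E" and x: "x \<in> carrier G" for E x
  proof (intro exI conjI)
    let ?F = "E <#> generate G {x}"
    have X: "subgroup (generate G {x}) G" using x by (intro generate_is_subgroup) simp
    have N: "E \<lhd> G" using derived_le_imp_normal E D by blast
    show "subgroup ?F G" using mult_norm_subgroup[OF N X] .
    have EG: "E \<subseteq> carrier G" using E by (simp add: subgroup.subset)
    show "E \<subseteq> ?F"
    proof
      fix e assume "e \<in> E"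
      then have "e \<otimes> \<one> \<in> ?F" unfolding set_mult_def using generate.one by blast
      then show "e \<in> ?F" using EG \<open>e \<in> E\<close> by auto
    qed
    have "\<one> \<otimes> x \<in> ?F"
      unfolding set_mult_def using subgroup.one_closed[OF E(1)] generate.incl[of x "{x}"] by blast
    then show "x \<in> ?F" using x by simp
    show "card ?F \<le> p * card E"
      using card_normal_mult_cyclic_le[OF N fin x p] pow[OF x] E by blast
  qed
  obtain E where E: "subgroup E G" "D \<subseteq> E" "a \<in> E" "card E \<le> p * card D"
    using extend[OF D(1) _ ab(1)] by blast
  obtain F where F: "subgroup F G" "E \<subseteq> F" "b \<in> F" "card F \<le> p * card E"
    using extend[OF E(1,2) ab(2)] by blast
  have "carrier G \<subseteq> F" using ab(3) generate_subgroup_incl[OF _ F(1), of "{a, b}"] E F by auto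
  then have "order G \<le> card F"
    using fin F(1) unfolding order_def by (meson card_mono finite_subset subgroup.subset)
  also have "\<dots> \<le> p * (p * card D)" using F(4) E(4) by (meson le_trans mult_le_mono2)
  finally show ?thesis by (simp add: power2_eq_square mult.assoc)
qed

section \<open>Counting generating pairs\<close>

text \<open>
  The right-hand side of the first equation is the Frattini subgroup. It is squeezed: two
  generators bound its index from above by \<open>p\<^sup>2\<close>, and inside \<open>N\<close> the proper subgroup \<open>M \<inter> N\<close> has
  index at least \<open>p\<close>, which bounds the index of \<open>M \<inter> N\<close> from below by \<open>p\<^sup>2\<close>.
\<close>

lemma prime_index_normals_Int:
  assumes p: "Factorial_Ring.prime (p::nat)" and ord: "order G = p ^ n"
    and ab: "(a, b) \<in> generating_pairs G"
    and M: "M \<in> prime_index_normals p" and N: "N \<in> prime_index_normals p" and "M \<noteq> N"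
  shows "M \<inter> N = \<Inter>(prime_index_normals p)"
    and "card (\<Inter>(prime_index_normals p)) * p\<^sup>2 = order G"
proof -
  let ?\<Phi> = "\<Inter>(prime_index_normals p)"
  note fin = finite_carrier_if_order_prime_power[OF p ord]
  have sub: "subgroup K G" if "K \<in> prime_index_normals p" for K
    using that by (simp add: prime_index_normals_def normal_imp_subgroup)
  have \<Phi>: "subgroup ?\<Phi> G" using M sub by (intro subgroups_Inter) auto
  have "order G \<le> p\<^sup>2 * card ?\<Phi>"
    by (rule order_le_of_two_generators[OF fin, of p a b])
       (use ab p \<Phi> derived_le_prime_index_normal[OF p fin] pow_in_prime_index_normal[OF p fin]
         in \<open>auto simp: generating_pairs_def prime_gt_0_nat\<close>)
  moreover have "card ?\<Phi> \<le> card (M \<inter> N)"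
    using M N finite_subset[OF subgroup.subset[OF sub[OF M]] fin] by (intro card_mono) auto
  moreover have MN: "card (M \<inter> N) * p\<^sup>2 \<le> order G"
  proof -
    have fN: "finite N" using finite_subset[OF subgroup.subset[OF sub[OF N]] fin] .
    have cN: "card N * p = order G" and cM: "card M * p = order G"
      using M N by (auto simp: prime_index_normals_def)
    have "card N = card M" using cN cM p by (metis mult_right_cancel not_prime_0)
    then have "M \<inter> N \<noteq> N"
      using \<open>M \<noteq> N\<close> card_subset_eq[of M N] finite_subset[OF subgroup.subset[OF sub[OF M]] fin] by blast
    have "subgroup (M \<inter> N) (G\<lparr>carrier := N\<rparr>)"
      using sub M N by (intro subgroup_incl subgroups_Inter_pair) auto
    then have "card (M \<inter> N) dvd order (G\<lparr>carrier := N\<rparr>)"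
      using group.lagrange[OF subgroup_imp_group[OF sub[OF N]]] by (metis dvd_triv_right)
    then obtain i where i: "card N = card (M \<inter> N) * i" by (auto simp: order_def)
    have "i dvd p ^ n" using i cN ord by (metis dvd_def mult.assoc mult.commute)
    moreover have "i \<noteq> 1" using i \<open>M \<inter> N \<noteq> N\<close> card_subset_eq[OF fN, of "M \<inter> N"] by auto
    ultimately have "p dvd i"
      using prime_dvd_if_dvd_power[OF p] by blast
    moreover have "i > 0" using \<open>i dvd p ^ n\<close> p by (metis dvd_0_left_iff gr0I not_prime_0 power_not_zero)
    ultimately have "p \<le> i" by (simp add: dvd_imp_le)
    then have "card (M \<inter> N) * p * p \<le> card N * p" using i by simp
    then show ?thesis using cN by (simp add: power2_eq_square mult.assoc)
  qed
  ultimately have eq: "card ?\<Phi> * p\<^sup>2 = order G" and le: "order G \<le> p\<^sup>2 * card ?\<Phi>"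
    by (auto simp: mult.commute intro: order.antisym le_trans[OF mult_le_mono1])
  show "card ?\<Phi> * p\<^sup>2 = order G" by (rule eq)
  have "card (M \<inter> N) \<le> card ?\<Phi>"
    using MN eq p by (metis mult_le_cancel2 prime_gt_0_nat zero_less_power)
  then show "M \<inter> N = ?\<Phi>"
    using M N finite_subset[OF subgroup.subset[OF sub[OF M]] fin] by (intro card_seteq[symmetric]) auto
qed

text \<open>
  The pairs are counted by their first component: it ranges over the complement of the Frattini
  subgroup, and then the second component ranges over the complement of the unique subgroup of
  index \<open>p\<close> through the first.
\<close>

lemma card_generating_pairs:
  assumes p: "Factorial_Ring.prime (p::nat)" and ord: "order G = p ^ n"
    and ab: "(a, b) \<in> generating_pairs G"
    and noncyclic: "\<And>c. c \<in> carrier G \<Longrightarrow> generate G {c} \<noteq> carrier G"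
  shows "n \<ge> 2" and "card (generating_pairs G) = p ^ (2 * (n - 2)) * ((p\<^sup>2 - 1) * (p\<^sup>2 - p))"
proof -
  let ?\<M> = "prime_index_normals p" and ?\<Phi> = "\<Inter>(prime_index_normals p)"
  note fin = finite_carrier_if_order_prime_power[OF p ord]
  have sub: "subgroup K G" if "K \<in> ?\<M>" for K
    using that by (simp add: prime_index_normals_def normal_imp_subgroup)
  have subG: "K \<subseteq> carrier G" if "K \<in> ?\<M>" for K using sub[OF that] by (rule subgroup.subset)
  have proper: "K \<noteq> carrier G" if "K \<in> ?\<M>" for K
  proof
    assume "K = carrier G"
    then have "order G * p = order G" using that by (simp add: prime_index_normals_def order_def)
    then show False using p ord by (simp add: prime_gt_0_nat prime_nat_iff)
  qed
  \<comment> \<open>This is where \<open>G\<close> must not be cyclic: a single element never escapes all the maximal subgroups.\<close>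
  have ex: "\<exists>M\<in>?\<M>. c \<in> M" if c: "c \<in> carrier G" for c
  proof -
    have "subgroup (generate G {c}) G" using c by (intro generate_is_subgroup) simp
    then obtain M where "M \<in> ?\<M>" "generate G {c} \<subseteq> M"
      using proper_subgroup_le_prime_index_normal[OF p ord] noncyclic[OF c] by blast
    then show ?thesis using generate.incl[of c "{c}" G] by blast
  qed
  have gen_iff: "generate G {c, d} = carrier G \<longleftrightarrow> (\<forall>M\<in>?\<M>. \<not> (c \<in> M \<and> d \<in> M))"
    if cd: "c \<in> carrier G" "d \<in> carrier G" for c d
  proof
    assume gen: "generate G {c, d} = carrier G"
    show "\<forall>M\<in>?\<M>. \<not> (c \<in> M \<and> d \<in> M)"
    proof (intro ballI notI)
      fix M assume M: "M \<in> ?\<M>" "c \<in> M \<and> d \<in> M"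
      then have "carrier G \<subseteq> M" using gen generate_subgroup_incl[OF _ sub, of "{c, d}"] by auto
      then show False using proper subG M by blast
    qed
  next
    assume *: "\<forall>M\<in>?\<M>. \<not> (c \<in> M \<and> d \<in> M)"
    show "generate G {c, d} = carrier G"
    proof (rule ccontr)
      assume "generate G {c, d} \<noteq> carrier G"
      moreover have "subgroup (generate G {c, d}) G" using cd by (intro generate_is_subgroup) simp
      ultimately obtain M where "M \<in> ?\<M>" "generate G {c, d} \<subseteq> M"
        using proper_subgroup_le_prime_index_normal[OF p ord] by blast
      then show False using * generate.incl[of _ "{c, d}" G] by blast
    qed
  qed
  have abG: "a \<in> carrier G" "b \<in> carrier G" "generate G {a, b} = carrier G"
    using ab by (auto simp: generating_pairs_def)
  obtain A where A: "A \<in> ?\<M>" "a \<in> A" using ex abG by blast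
  obtain B where B: "B \<in> ?\<M>" "b \<in> B" using ex abG by blast
  have "A \<noteq> B" using gen_iff[OF abG(1,2)] abG(3) A B by blast
  note Int = prime_index_normals_Int[OF p ord ab]
  have c\<Phi>: "card ?\<Phi> * p\<^sup>2 = p ^ n" using Int(2)[OF A(1) B(1) \<open>A \<noteq> B\<close>] ord by simp
  then have "p\<^sup>2 dvd p ^ n" by (metis dvd_triv_right)
  then show n2: "n \<ge> 2" using power_dvd_imp_le[of p 2 n] prime_gt_1_nat[OF p] by simp
  define m where "m = n - 2"
  have n: "n = m + 2" using n2 by (simp add: m_def)
  have p0: "p > 0" using p by (rule prime_gt_0_nat)
  have card\<Phi>: "card ?\<Phi> = p ^ m" using c\<Phi> p0 unfolding n power_add by simp
  have cardM: "card M = p ^ (m + 1)" if "M \<in> ?\<M>" for M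
  proof -
    have "card M * p = p ^ (m + 1) * p" using that ord by (auto simp: prime_index_normals_def n)
    then show ?thesis using p0 by simp
  qed
  \<comment> \<open>For \<open>c\<close> outside \<open>?\<Phi>\<close> the choice is unique, as two candidates would meet in \<open>?\<Phi>\<close>.\<close>
  define M where "M c = (SOME M. M \<in> ?\<M> \<and> c \<in> M)" for c
  have M: "M c \<in> ?\<M>" "c \<in> M c" if "c \<in> carrier G" for c
    using someI_ex[of "\<lambda>M. M \<in> ?\<M> \<and> c \<in> M"] ex[OF that] unfolding M_def by blast+
  have M_unique: "K = M c" if "c \<in> carrier G" "c \<notin> ?\<Phi>" "K \<in> ?\<M>" "c \<in> K" for c K
    using Int(1)[of K "M c"] M[OF that(1)] that by blast
  have "generating_pairs G = (SIGMA c:carrier G - ?\<Phi>. carrier G - M c)"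
  proof (intro equalityI subrelI)
    fix c d assume "(c, d) \<in> generating_pairs G"
    then have cd: "c \<in> carrier G" "d \<in> carrier G" "\<forall>K\<in>?\<M>. \<not> (c \<in> K \<and> d \<in> K)"
      using gen_iff by (auto simp: generating_pairs_def)
    then show "(c, d) \<in> (SIGMA c:carrier G - ?\<Phi>. carrier G - M c)"
      using M[OF cd(1)] M[OF cd(2)] by blast
  next
    fix c d assume "(c, d) \<in> (SIGMA c:carrier G - ?\<Phi>. carrier G - M c)"
    then have cd: "c \<in> carrier G" "c \<notin> ?\<Phi>" "d \<in> carrier G" "d \<notin> M c" by auto
    then have "\<forall>K\<in>?\<M>. \<not> (c \<in> K \<and> d \<in> K)" using M_unique by metis
    then show "(c, d) \<in> generating_pairs G" using gen_iff cd by (simp add: generating_pairs_def)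
  qed
  moreover have "card (carrier G - M c) = p ^ n - p ^ (m + 1)" if "c \<in> carrier G - ?\<Phi>" for c
  proof -
    have "M c \<in> ?\<M>" using that M by blast
    then show ?thesis
      using subG[of "M c"] cardM[of "M c"] fin ord
      by (subst card_Diff_subset) (auto simp: order_def intro: finite_subset)
  qed
  moreover have "card (carrier G - ?\<Phi>) = p ^ n - p ^ m"
    using fin subG A(1) card\<Phi> ord
    by (subst card_Diff_subset) (auto simp: order_def intro: finite_subset)
  ultimately have "card (generating_pairs G) = (p ^ n - p ^ m) * (p ^ n - p ^ (m + 1))"
    using fin by (simp add: card_SigmaI)
  also have "\<dots> = (p ^ m * (p\<^sup>2 - 1)) * (p ^ m * (p\<^sup>2 - p))"
  proof -
    have "p ^ n - p ^ m = p ^ m * (p\<^sup>2 - 1)" unfolding n power_add diff_mult_distrib2 by simp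
    moreover have "p ^ n - p ^ (m + 1) = p ^ m * (p\<^sup>2 - p)"
      unfolding n power_add diff_mult_distrib2 by simp
    ultimately show ?thesis by simp
  qed
  also have "\<dots> = p ^ (2 * (n - 2)) * ((p\<^sup>2 - 1) * (p\<^sup>2 - p))"
    by (simp add: n mult_2 power_add)
  finally show "card (generating_pairs G) = p ^ (2 * (n - 2)) * ((p\<^sup>2 - 1) * (p\<^sup>2 - p))" .
qed

section \<open>Automorphisms acting on generating pairs\<close>

lemma auto_eq_on_generating_pair:
  assumes f: "f \<in> auto G" and g: "g \<in> auto G" and ab: "(a, b) \<in> generating_pairs G"
    and "f a = g a" "f b = g b"
  shows "f = g"
proof -
  interpret f: group_hom G G f using f by unfold_locales (simp add: auto_def)
  interpret g: group_hom G G g using g by unfold_locales (simp add: auto_def)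
  have ab': "a \<in> carrier G" "b \<in> carrier G" "generate G {a, b} = carrier G"
    using ab by (auto simp: generating_pairs_def)
  have "f x = g x" if "x \<in> generate G {a, b}" for x
    using that
  proof induction
    case one
    then show ?case by simp
  next
    case (incl h)
    then show ?case using assms by auto
  next
    case (inv h)
    then show ?case using assms ab' by auto
  next
    case (eng h k)
    then show ?case using ab' by simp
  qed
  then show ?thesis
    using f g ab' by (intro extensionalityI[of f "carrier G"]) (auto simp: auto_def Bij_def)
qed

lemma auto_image_generating_pair:
  assumes s: "s \<in> auto G" and ab: "(a, b) \<in> generating_pairs G"
  shows "(s a, s b) \<in> generating_pairs G"
proof -
  interpret s: group_hom G G s using s by unfold_locales (simp add: auto_def)
  have "s ` carrier G = carrier G" using s by (auto simp: auto_def Bij_def bij_betw_def)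
  then show ?thesis using s.generate_img[of "{a, b}"] ab by (auto simp: generating_pairs_def)
qed

text \<open>
  By \<open>auto_eq_on_generating_pair\<close> each orbit has \<open>order (AutoGroup G)\<close> elements, so it exhausts the
  finite set of generating pairs exactly when the two cardinalities agree.
\<close>

lemma determines_unique_iff_card_auto:
  assumes fin: "finite (carrier G)" and ne: "generating_pairs G \<noteq> {}"
  shows "determines_unique_regular_dessin G \<longleftrightarrow> order (AutoGroup G) = card (generating_pairs G)"
proof -
  let ?P = "generating_pairs G" and ?orb = "orbit (AutoGroup G) (\<lambda>f. map_prod f f)"
  have finP: "finite ?P"
    by (rule finite_subset[of _ "carrier G \<times> carrier G"]) (use fin in \<open>auto simp: generating_pairs_def\<close>)
  have orb: "?orb q = (\<lambda>s. map_prod s s q) ` auto G" for q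
    by (auto simp: orbit_def AutoGroup_def)
  have sub: "?orb q \<subseteq> ?P" if "q \<in> ?P" for q
    unfolding orb using auto_image_generating_pair that by (cases q) auto
  have card: "card (?orb q) = order (AutoGroup G)" if "q \<in> ?P" for q
  proof -
    have "inj_on (\<lambda>s. map_prod s s q) (auto G)"
      using auto_eq_on_generating_pair that by (cases q) (auto intro!: inj_onI)
    then show ?thesis unfolding orb by (simp add: card_image order_def AutoGroup_def)
  qed
  have refl: "q \<in> ?orb q" if "q \<in> ?P" for q
    unfolding orb using that
    by (intro image_eqI[OF _ id_in_auto]) (auto simp: generating_pairs_def)
  show ?thesis
  proof
    assume "determines_unique_regular_dessin G"
    then obtain O1 where O: "orbits (AutoGroup G) ?P (\<lambda>f. map_prod f f) = {O1}"
      by (auto simp: determines_unique_regular_dessin_def card_1_singleton_iff)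
    have O1: "?orb q = O1" if "q \<in> ?P" for q
    proof -
      have "?orb q \<in> orbits (AutoGroup G) ?P (\<lambda>f. map_prod f f)"
        unfolding orbits_def using that by blast
      then show ?thesis by (simp add: O)
    qed
    obtain q where q: "q \<in> ?P" using ne by blast
    have "?orb q = ?P" using sub[OF q] refl O1 q by blast
    then show "order (AutoGroup G) = card ?P" using card[OF q] by simp
  next
    assume *: "order (AutoGroup G) = card ?P"
    have "?orb q = ?P" if "q \<in> ?P" for q
      using card_subset_eq[OF finP sub[OF that]] card[OF that] * by simp
    then have "orbits (AutoGroup G) ?P (\<lambda>f. map_prod f f) = {?P}"
      using ne unfolding orbits_def by blast
    then show "determines_unique_regular_dessin G"
      by (simp add: determines_unique_regular_dessin_def)
  qed
qed

end

lemma min_generators_minimal: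
  assumes "S \<subseteq> carrier G" "finite S" "generate G S = carrier G"
  shows "min_generators G \<le> card S"
  unfolding min_generators_def using assms by (intro Least_le) blast

lemma min_generators_witness:
  assumes "group G" "finite (carrier G)"
  obtains S where "S \<subseteq> carrier G" "card S = min_generators G" "generate G S = carrier G"
proof -
  interpret group G by fact
  have "generate G (carrier G) = carrier G"
    using generate_incl[of "carrier G"] generate.incl[of _ "carrier G" G] by blast
  then have "\<exists>d. \<exists>S\<subseteq>carrier G. finite S \<and> card S = d \<and> generate G S = carrier G"
    using assms(2) by blast
  from LeastI_ex[OF this] show thesis
    using that unfolding min_generators_def by blast
qed

theorem theorem3:
  fixes G :: "('a, 'b) monoid_scheme" and p :: nat
  assumes "Factorial_Ring.prime p"
    and "group G"
    and "\<exists>n. order G = p ^ n"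
    and "min_generators G = 2"
  shows "determines_unique_regular_dessin G \<longleftrightarrow> maximally_automorphic p G"
proof -
  interpret group G by fact
  obtain n where n: "order G = p ^ n" using assms(3) by blast
  note fin = finite_carrier_if_order_prime_power[OF assms(1) n]
  obtain S where S: "S \<subseteq> carrier G" "card S = 2" "generate G S = carrier G"
    using min_generators_witness[OF assms(2) fin] assms(4) by metis
  then obtain a b where ab: "S = {a, b}" by (metis card_2_iff)
  then have pair: "(a, b) \<in> generating_pairs G" using S by (auto simp: generating_pairs_def)
  have noncyclic: "generate G {c} \<noteq> carrier G" if "c \<in> carrier G" for c
    using min_generators_minimal[of "{c}" G] that assms(4) by auto
  have count: "card (generating_pairs G) = p ^ (2 * (n - 2)) * ((p\<^sup>2 - 1) * (p\<^sup>2 - p))"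
    using card_generating_pairs(2)[OF assms(1) n pair noncyclic] by blast
  have unique_n: "p ^ k = p ^ n \<longleftrightarrow> k = n" for k
    using prime_gt_1_nat[OF assms(1)] by simp
  have "maximally_automorphic p G \<longleftrightarrow>
      order (AutoGroup G) = p ^ (2 * (n - 2)) * (\<Prod>i<2. p\<^sup>2 - p ^ i)"
    using n unique_n unfolding maximally_automorphic_def assms(4) Let_def by metis
  also have "(\<Prod>i<2. p\<^sup>2 - p ^ i) = (p\<^sup>2 - 1) * (p\<^sup>2 - p)"
    by (simp add: numeral_2_eq_2)
  finally show ?thesis
    using determines_unique_iff_card_auto[OF fin] pair count by auto
qed

end
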